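(* Assume $q\ge c_q$ for some constant $c_q>0$. Then for any integers $0\le t<T_0\le T$ and any $\mu\in\mathcal P_0(\mathbb S)$, $$\mathbb V_{state}(t,\mu)=\bigcap_{\varepsilon>0}\Big\{\varphi\in\mathbb L^0(\mathbb S;\mathbb R):\ \|\varphi-J(T_0,\psi;t,\mu,\alpha^*;\cdot,\alpha^* )\|_\infty\le\varepsilon\ \text{ for some }\psi\in\mathbb L^0(\mathbb S\times\mathcal P_0(\mathbb S);\mathbb R)\text{ and }\alpha^*\in\mathcal A_{state}$$ $$\text{such that }\psi(\cdot,\mu^{\alpha^*}_{T_0})\in\mathbb V^\varepsilon_{state}(T_0,\mu^{\alpha^*}_{T_0})\text{ and }\alpha^*\in\mathcal M^\varepsilon_{state}(T_0,\psi;t,\mu)\Big\},$$ where $\mu^{\alpha^*}$ is the flow of marginals started from $(t,\mu)$ under the control $\alpha^*$.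
   Context: Setting (discrete mean field game). $\mathbb T=\{0,\dots,T\}$; $\mathbb S$ is a finite set with $|\mathbb S|=d$; $\mathcal P(\mathbb S)$ is the set of probability measures on $\mathbb S$ with the distance $W_1(\mu,\nu):=\sum_{x\in\mathbb S}|\mu(x)-\nu(x)|$; $\mathcal P_0(\mathbb S)\subset\mathcal P(\mathbb S)$ consists of measures with full support. $\mathbb A\subset\mathbb R^{d_0}$ is a measurable set. $q:\mathbb T\times\mathbb S\times\mathcal P(\mathbb S)\times\mathbb A\times\mathbb S\to(0,1)$ is a transition probability function: $\sum_{\tilde x\in\mathbb S}q(t,x,\mu,a;\tilde x)=1$. $F:\mathbb T\times\mathbb S\times\mathcal P(\mathbb S)\times\mathbb A\to\mathbb R$ and $G:\mathbb S\times\mathcal P(\mathbb S)\to\mathbb R$ are measurable with $\inf_{a\in\mathbb A}F(t,x,\mu,a)>-\infty$ for all $(t,x,\mu)$. $\mathbb L^0(E;\mathbb R)$ denotes the measurable functions $E\to\mathbb R$. $X$ is the canonical process on $\Omega=\mathbb S^{T+1}$. $\mathcal A_{state}$ is the set of all maps $\alpha:\mathbb T\times\mathbb S\to\mathbb A$. For $(t,\mu,\alpha)\in\mathbb T\times\mathcal P(\mathbb S)\times\mathcal A_{state}$, $\mathbb P^{t,\mu,\alpha}$ is the law of $(X_s)_{s\ge t}$ determined by $\mathbb P^{t,\mu,\alpha}\circ X_t^{-1}=\mu$ and $\mathbb P^{t,\mu,\alpha}(X_{s+1}=\tilde x|X_s=x)=q(s,x,\mu^\alpha_s,\alpha(s,x);\tilde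 x)$, where $\mu^\alpha_s:=\mathbb P^{t,\mu,\alpha}\circ X_s^{-1}$ (so $\mu^\alpha$ depends on $(t,\mu)$). For a flow $\{\mu_\cdot\}$, $x\in\mathbb S$ and $\tilde\alpha\in\mathcal A_{state}$, $\mathbb P^{\{\mu_\cdot\};t,x,\tilde\alpha}$ is determined by $X_t=x$ a.s. and $\mathbb P(X_{s+1}=\bar x|X_s=\tilde x)=q(s,\tilde x,\mu_s,\tilde\alpha(s,\tilde x);\bar x)$, $s\ge t$. Costs: $J(\{\mu_\cdot\};t,x,\tilde\alpha):=\mathbb E^{\mathbb P^{\{\mu_\cdot\};t,x,\tilde\alpha}}\big[G(X_T,\mu_T)+\sum_{r=t}^{T-1}F(r,X_r,\mu_r,\tilde\alpha(r,X_r))\big]$, $J(t,\mu,\alpha;x,\tilde\alpha):=J(\mu^\alpha;t,x,\tilde\alpha)$, $v(\{\mu_\cdot\};t,x):=\inf_{\tilde\alpha\in\mathcal A_{state}}J(\{\mu_\cdot\};t,x,\tilde\alpha)$. Set value: for $\mu\in\mathcal P_0(\mathbb S)$ and $\varepsilon>0$, $\mathcal M^\varepsilon_{state}(t,\mu)$ is the set of $\alpha^*\in\mathcal A_{state}$ with $J(t,\mu,\alpha^*;x,\alpha^* )\le v(\mu^{\alpha^*};t,x)+\varepsilon$ for all $x\in\mathbb S$; $\mathbb V^\varepsilon_{state}(t,\mu):=\{\varphi\in\mathbb L^0(\mathbb S;\mathbb R):\|\varphi-J(t,\mu,\alpha^*;\cdot,\alpha^* )\|_\infty\le\varepsilon\text{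 for some }\alpha^*\in\mathcal M^\varepsilon_{state}(t,\mu)\}$; $\mathbb V_{state}(t,\mu):=\bigcap_{\varepsilon>0}\mathbb V^\varepsilon_{state}(t,\mu)$. Game on $\{t,\dots,T_0\}$: for $\psi\in\mathbb L^0(\mathbb S\times\mathcal P_0(\mathbb S);\mathbb R)$, $J(T_0,\psi;t,\mu,\alpha;x,\tilde\alpha):=\mathbb E^{\mathbb P^{\mu^\alpha;t,x,\tilde\alpha}}\big[\psi(X_{T_0},\mu^\alpha_{T_0})+\sum_{s=t}^{T_0-1}F(s,X_s,\mu^\alpha_s,\tilde\alpha(s,X_s))\big]$, and $\mathcal M^\varepsilon_{state}(T_0,\psi;t,\mu)$ is the set of $\alpha^*\in\mathcal A_{state}$ with $J(T_0,\psi;t,\mu,\alpha^*;x,\alpha^* )\le\inf_{\alpha\in\mathcal A_{state}}J(T_0,\psi;t,\mu,\alpha^*;x,\alpha)+\varepsilon$ for all $x\in\mathbb S$. *)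

theory Defs
  imports "HOL-Probability.Probability"
begin

text \<open>
  The state space is the finite type \<open>'s\<close>, with every subset measurable.
  Since \<open>'s\<close> is finite, \<open>'s pmf\<close> is the set of all probability measures on it.
  The transition function is \<open>pmf\<close>-valued: \<open>pmf (q s x \<mu> a) y\<close> is \<open>q(s,x,\<mu>,a;y)\<close>, and summing
  to one is built into the type. Its values for times \<open>s > T\<close> or actions outside \<open>A\<close> are
  never used.
\<close>

definition W1 :: "'s::finite pmf \<Rightarrow> 's pmf \<Rightarrow> real" where
  "W1 \<mu> \<nu> = (\<Sum>x\<in>UNIV. \<bar>pmf \<mu> x - pmf \<nu> x\<bar>)"

lemma Metric_space_W1: "Metric_space UNIV (W1 :: 's::finite pmf \<Rightarrow> 's pmf \<Rightarrow> real)"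
proof
  show "0 \<le> W1 \<mu> \<nu>" for \<mu> \<nu> :: "'s pmf"
    by (auto simp: W1_def intro: sum_nonneg)
  show "W1 \<mu> \<nu> = W1 \<nu> \<mu>" for \<mu> \<nu> :: "'s pmf"
    by (simp add: W1_def abs_minus_commute)
  show "W1 \<mu> \<nu> = 0 \<longleftrightarrow> \<mu> = \<nu>" for \<mu> \<nu> :: "'s pmf"
    by (auto simp: W1_def sum_nonneg_eq_0_iff intro: pmf_eqI)
  show "W1 \<mu> \<rho> \<le> W1 \<mu> \<nu> + W1 \<nu> \<rho>" for \<mu> \<nu> \<rho> :: "'s pmf"
    by (auto simp: W1_def simp flip: sum.distrib intro!: sum_mono)
qed

text \<open>The Borel sigma-algebra of the metric \<open>W1\<close>; measurability in the measure argument refers to it.\<close>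

definition borel_pmf :: "'s::finite pmf measure" where
  "borel_pmf = sigma UNIV {U. openin (Metric_space.mtopology UNIV W1) U}"

definition full_support :: "'s::finite pmf set" where
  "full_support = {\<mu>. set_pmf \<mu> = UNIV}"

text \<open>
  A control is a map \<open>{0..T} \<times> 's \<rightarrow> A\<close>, curried; as HOL functions are total, the values
  at times beyond \<open>T\<close> are left unconstrained, and nothing below depends on them.
\<close>

definition controls :: "nat \<Rightarrow> 'a set \<Rightarrow> (nat \<Rightarrow> 's \<Rightarrow> 'a) set" where
  "controls T A = {\<alpha>. \<forall>s\<le>T. \<forall>x. \<alpha> s x \<in> A}"

text \<open>
  \<open>path_law \<kappa> t \<mu> n\<close> is the law of the path \<open>(X t, \<dots>, X (t + n))\<close> with \<open>X t\<close> distributed as \<open>\<mu>\<close>,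
  where, given the past up to time \<open>s\<close>, the next state is drawn from \<open>\<kappa> s \<nu> (X s)\<close> for \<open>\<nu>\<close> the
  law of \<open>X s\<close> itself (McKean--Vlasov dynamics). Paths are functions on all of \<open>nat\<close> and
  carry no information outside \<open>{t..t + n}\<close>. The lemmas below confirm that this law has
  the prescribed initial marginal and conditional transition probabilities.
\<close>

primrec path_law ::
  "(nat \<Rightarrow> 's pmf \<Rightarrow> 's \<Rightarrow> 's pmf) \<Rightarrow> nat \<Rightarrow> 's pmf \<Rightarrow> nat \<Rightarrow> (nat \<Rightarrow> 's) pmf" where
  "path_law \<kappa> t \<mu> 0 = map_pmf (\<lambda>x. (\<lambda>_. undefined)(t := x)) \<mu>"
| "path_law \<kappa> t \<mu> (Suc n) =
     bind_pmf (path_law \<kappa> t \<mu> n)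
       (\<lambda>w. map_pmf (\<lambda>y. w(Suc (t + n) := y))
              (\<kappa> (t + n) (map_pmf (\<lambda>w'. w' (t + n)) (path_law \<kappa> t \<mu> n)) (w (t + n))))"

lemma path_law_initial: "map_pmf (\<lambda>w. w t) (path_law \<kappa> t \<mu> n) = \<mu>"
  by (induction n) (simp_all add: map_bind_pmf pmf.map_comp o_def map_pmf_def[symmetric])

lemma path_law_extend:
  assumes "\<And>w i y. i > t + n \<Longrightarrow> f (w(i := y)) = f w"
  shows "map_pmf f (path_law \<kappa> t \<mu> (n + k)) = map_pmf f (path_law \<kappa> t \<mu> n)"
proof (induction k)
  case (Suc k)
  then show ?case
    by (simp add: map_bind_pmf pmf.map_comp o_def assms) (simp add: map_pmf_def)
qed simp

lemma path_law_transition: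
  assumes s: "t \<le> s" "s < t + n"
    and B: "\<And>w i z. i > s \<Longrightarrow> B (w(i := z)) = B w"
    and pos: "measure (path_law \<kappa> t \<mu> n) {w. w s = x \<and> B w} > 0"
  shows "\<P>(w in path_law \<kappa> t \<mu> n. w (Suc s) = y \<bar> w s = x \<and> B w)
         = pmf (\<kappa> s (map_pmf (\<lambda>w. w s) (path_law \<kappa> t \<mu> n)) x) y"
proof -
  define m k where "m = s - t" and "k = t + n - Suc s"
  have n: "n = Suc m + k" and st: "s = t + m"
    using s by (auto simp: m_def k_def)
  define P where "P = path_law \<kappa> t \<mu> m"
  define Q where "Q = path_law \<kappa> t \<mu> n"
  define K where "K = \<kappa> s (map_pmf (\<lambda>w. w s) P) x"
  define f where "f = (\<lambda>w. (w s, B w))"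
  define g where "g = (\<lambda>w. (w (Suc s), w s, B w))"
  have marg: "map_pmf (\<lambda>w. w s) Q = map_pmf (\<lambda>w. w s) P"
    unfolding P_def Q_def n add_Suc add_Suc_right[symmetric]
    by (rule path_law_extend) (auto simp: st)
  have ev: "map_pmf f Q = map_pmf f P"
    unfolding P_def Q_def n add_Suc add_Suc_right[symmetric]
    by (rule path_law_extend) (auto simp: st f_def B)
  have "map_pmf g Q = map_pmf g (path_law \<kappa> t \<mu> (Suc m))"
    unfolding Q_def n
    by (rule path_law_extend) (auto simp: st g_def B)
  also have "\<dots> = bind_pmf P (\<lambda>w. map_pmf (\<lambda>z. (z, w s, B w)) (\<kappa> s (map_pmf (\<lambda>w. w s) P) (w s)))"
    by (simp add: map_bind_pmf pmf.map_comp o_def P_def g_def st B)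
  finally have g: "map_pmf g Q = \<dots>" .
  have "measure Q {w. w (Suc s) = y \<and> w s = x \<and> B w} = pmf (map_pmf g Q) (y, x, True)"
    by (simp add: pmf_map g_def vimage_def)
  also have "\<dots> = measure_pmf.expectation P (\<lambda>w. pmf K y * indicator {w. w s = x \<and> B w} w)"
    unfolding g pmf_bind
  proof (rule Bochner_Integration.integral_cong[OF refl])
    fix w
    have *: "(\<lambda>z. (z, w s, B w)) -` {(y, x, True)} = (if w s = x \<and> B w then {y} else {})"
      by auto
    show "pmf (map_pmf (\<lambda>z. (z, w s, B w)) (\<kappa> s (map_pmf (\<lambda>w. w s) P) (w s))) (y, x, True)
      = pmf K y * indicator {w. w s = x \<and> B w} w"
      unfolding pmf_map * by (auto simp: K_def measure_pmf_single indicator_def)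
  qed
  also have "\<dots> = pmf K y * measure P {w. w s = x \<and> B w}"
    by simp
  also have "measure P {w. w s = x \<and> B w} = pmf (map_pmf f P) (x, True)"
    by (simp add: pmf_map f_def vimage_def)
  also have "\<dots> = measure Q {w. w s = x \<and> B w}"
    unfolding ev[symmetric] by (simp add: pmf_map f_def vimage_def)
  finally show ?thesis
    using pos unfolding Q_def[symmetric] marg K_def[symmetric] by (simp add: cond_prob_def)
qed

text \<open>The law \<open>P^{t,\<mu>,\<alpha>}\<close> of \<open>(X s)\<close>, \<open>t \<le> s \<le> T\<close>, and its flow of marginals \<open>\<mu>^\<alpha>\<close>.\<close>

definition mf_law ::
  "nat \<Rightarrow> (nat \<Rightarrow> 's \<Rightarrow> 's pmf \<Rightarrow> 'a \<Rightarrow> 's pmf) \<Rightarrow> nat \<Rightarrow> 's pmf \<Rightarrow> (nat \<Rightarrow> 's \<Rightarrow> 'a) \<Rightarrow>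
   (nat \<Rightarrow> 's) pmf" where
  "mf_law T q t \<mu> \<alpha> = path_law (\<lambda>s \<nu> x. q s x \<nu> (\<alpha> s x)) t \<mu> (T - t)"

definition mf_flow ::
  "nat \<Rightarrow> (nat \<Rightarrow> 's \<Rightarrow> 's pmf \<Rightarrow> 'a \<Rightarrow> 's pmf) \<Rightarrow> nat \<Rightarrow> 's pmf \<Rightarrow> (nat \<Rightarrow> 's \<Rightarrow> 'a) \<Rightarrow> nat \<Rightarrow> 's pmf" where
  "mf_flow T q t \<mu> \<alpha> s = map_pmf (\<lambda>w. w s) (mf_law T q t \<mu> \<alpha>)"

text \<open>The law \<open>P^{m;t,x,\<alpha>}\<close> of the Markov chain started at \<open>x\<close>, for a given flow \<open>m\<close>.\<close>

definition flow_law ::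
  "nat \<Rightarrow> (nat \<Rightarrow> 's \<Rightarrow> 's pmf \<Rightarrow> 'a \<Rightarrow> 's pmf) \<Rightarrow> (nat \<Rightarrow> 's pmf) \<Rightarrow> nat \<Rightarrow> 's \<Rightarrow> (nat \<Rightarrow> 's \<Rightarrow> 'a) \<Rightarrow> (nat \<Rightarrow> 's) pmf" where
  "flow_law T q m t x \<alpha> = path_law (\<lambda>s _ y. q s y (m s) (\<alpha> s y)) t (return_pmf x) (T - t)"

text \<open>
  The three costs \<open>J(m;t,x,\<alpha>)\<close>, \<open>J(t,\<mu>,\<alpha>;x,\<alpha>')\<close> and \<open>J(T0,\<psi>;t,\<mu>,\<alpha>;x,\<alpha>')\<close>. In the latter two, \<open>\<alpha>\<close>
  generates the flow and \<open>\<alpha>'\<close> is the control of the individual player. Paths are finitely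
  many up to null sets, so the expectations exist without measurability conditions.
\<close>

definition J_flow ::
  "nat \<Rightarrow> (nat \<Rightarrow> 's \<Rightarrow> 's pmf \<Rightarrow> 'a \<Rightarrow> 's pmf) \<Rightarrow> (nat \<Rightarrow> 's \<Rightarrow> 's pmf \<Rightarrow> 'a \<Rightarrow> real) \<Rightarrow>
   ('s \<Rightarrow> 's pmf \<Rightarrow> real) \<Rightarrow> (nat \<Rightarrow> 's pmf) \<Rightarrow> nat \<Rightarrow> 's \<Rightarrow> (nat \<Rightarrow> 's \<Rightarrow> 'a) \<Rightarrow> real" where
  "J_flow T q F G m t x \<alpha> =
     measure_pmf.expectation (flow_law T q m t x \<alpha>)
       (\<lambda>w. G (w T) (m T) + (\<Sum>r = t..<T. F r (w r) (m r) (\<alpha> r (w r))))"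

definition J ::
  "nat \<Rightarrow> (nat \<Rightarrow> 's \<Rightarrow> 's pmf \<Rightarrow> 'a \<Rightarrow> 's pmf) \<Rightarrow> (nat \<Rightarrow> 's \<Rightarrow> 's pmf \<Rightarrow> 'a \<Rightarrow> real) \<Rightarrow>
   ('s \<Rightarrow> 's pmf \<Rightarrow> real) \<Rightarrow> nat \<Rightarrow> 's pmf \<Rightarrow> (nat \<Rightarrow> 's \<Rightarrow> 'a) \<Rightarrow> 's \<Rightarrow> (nat \<Rightarrow> 's \<Rightarrow> 'a) \<Rightarrow> real" where
  "J T q F G t \<mu> \<alpha> x \<alpha>' = J_flow T q F G (mf_flow T q t \<mu> \<alpha>) t x \<alpha>'"

definition J_trunc ::
  "nat \<Rightarrow> (nat \<Rightarrow> 's \<Rightarrow> 's pmf \<Rightarrow> 'a \<Rightarrow> 's pmf) \<Rightarrow> (nat \<Rightarrow> 's \<Rightarrow> 's pmf \<Rightarrow> 'a \<Rightarrow> real) \<Rightarrow>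
   nat \<Rightarrow> ('s \<Rightarrow> 's pmf \<Rightarrow> real) \<Rightarrow> nat \<Rightarrow> 's pmf \<Rightarrow> (nat \<Rightarrow> 's \<Rightarrow> 'a) \<Rightarrow> 's \<Rightarrow> (nat \<Rightarrow> 's \<Rightarrow> 'a) \<Rightarrow> real"
  where
  "J_trunc T q F T0 \<psi> t \<mu> \<alpha> x \<alpha>' =
     (let m = mf_flow T q t \<mu> \<alpha> in
      measure_pmf.expectation (flow_law T q m t x \<alpha>')
        (\<lambda>w. \<psi> (w T0) (m T0) + (\<Sum>s = t..<T0. F s (w s) (m s) (\<alpha>' s (w s)))))"

text \<open>
  The infimum is a real one: it is over a set bounded below because \<open>F\<close> is bounded below in
  the action and the flow is fixed, and it is only used when a control exists.
\<close>

definition v_flow ::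
  "nat \<Rightarrow> 'a set \<Rightarrow> (nat \<Rightarrow> 's \<Rightarrow> 's pmf \<Rightarrow> 'a \<Rightarrow> 's pmf) \<Rightarrow> (nat \<Rightarrow> 's \<Rightarrow> 's pmf \<Rightarrow> 'a \<Rightarrow> real) \<Rightarrow>
   ('s \<Rightarrow> 's pmf \<Rightarrow> real) \<Rightarrow> (nat \<Rightarrow> 's pmf) \<Rightarrow> nat \<Rightarrow> 's \<Rightarrow> real" where
  "v_flow T A q F G m t x = (INF \<alpha>\<in>controls T A. J_flow T q F G m t x \<alpha>)"

definition sup_norm :: "('s \<Rightarrow> real) \<Rightarrow> real" where
  "sup_norm f = (SUP x. \<bar>f x\<bar>)"

definition M_state ::
  "nat \<Rightarrow> 'a set \<Rightarrow> (nat \<Rightarrow> 's \<Rightarrow> 's pmf \<Rightarrow> 'a \<Rightarrow> 's pmf) \<Rightarrow> (nat \<Rightarrow> 's \<Rightarrow> 's pmf \<Rightarrow> 'a \<Rightarrow> real) \<Rightarrow>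
   ('s \<Rightarrow> 's pmf \<Rightarrow> real) \<Rightarrow> real \<Rightarrow> nat \<Rightarrow> 's pmf \<Rightarrow> (nat \<Rightarrow> 's \<Rightarrow> 'a) set" where
  "M_state T A q F G \<epsilon> t \<mu> =
     {\<alpha>\<in>controls T A. \<forall>x. J T q F G t \<mu> \<alpha> x \<alpha> \<le> v_flow T A q F G (mf_flow T q t \<mu> \<alpha>) t x + \<epsilon>}"

definition V_state_eps ::
  "nat \<Rightarrow> 'a set \<Rightarrow> (nat \<Rightarrow> 's \<Rightarrow> 's pmf \<Rightarrow> 'a \<Rightarrow> 's pmf) \<Rightarrow> (nat \<Rightarrow> 's \<Rightarrow> 's pmf \<Rightarrow> 'a \<Rightarrow> real) \<Rightarrow>
   ('s \<Rightarrow> 's pmf \<Rightarrow> real) \<Rightarrow> real \<Rightarrow> nat \<Rightarrow> 's pmf \<Rightarrow> ('s \<Rightarrow> real) set" where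
  "V_state_eps T A q F G \<epsilon> t \<mu> =
     {\<phi>\<in>borel_measurable (count_space UNIV).
        \<exists>\<alpha>\<in>M_state T A q F G \<epsilon> t \<mu>. sup_norm (\<lambda>x. \<phi> x - J T q F G t \<mu> \<alpha> x \<alpha>) \<le> \<epsilon>}"

definition V_state ::
  "nat \<Rightarrow> 'a set \<Rightarrow> (nat \<Rightarrow> 's \<Rightarrow> 's pmf \<Rightarrow> 'a \<Rightarrow> 's pmf) \<Rightarrow> (nat \<Rightarrow> 's \<Rightarrow> 's pmf \<Rightarrow> 'a \<Rightarrow> real) \<Rightarrow>
   ('s \<Rightarrow> 's pmf \<Rightarrow> real) \<Rightarrow> nat \<Rightarrow> 's pmf \<Rightarrow> ('s \<Rightarrow> real) set" where
  "V_state T A q F G t \<mu> = (\<Inter>\<epsilon>\<in>{0<..}. V_state_eps T A q F G \<epsilon> t \<mu>)"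

definition M_trunc ::
  "nat \<Rightarrow> 'a set \<Rightarrow> (nat \<Rightarrow> 's \<Rightarrow> 's pmf \<Rightarrow> 'a \<Rightarrow> 's pmf) \<Rightarrow> (nat \<Rightarrow> 's \<Rightarrow> 's pmf \<Rightarrow> 'a \<Rightarrow> real) \<Rightarrow>
   real \<Rightarrow> nat \<Rightarrow> ('s \<Rightarrow> 's pmf \<Rightarrow> real) \<Rightarrow> nat \<Rightarrow> 's pmf \<Rightarrow> (nat \<Rightarrow> 's \<Rightarrow> 'a) set" where
  "M_trunc T A q F \<epsilon> T0 \<psi> t \<mu> =
     {\<alpha>\<in>controls T A. \<forall>x. J_trunc T q F T0 \<psi> t \<mu> \<alpha> x \<alpha>
        \<le> (INF \<alpha>'\<in>controls T A. J_trunc T q F T0 \<psi> t \<mu> \<alpha> x \<alpha>') + \<epsilon>}"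

text \<open>
  Terminal payoffs \<open>\<psi>\<close>, i.e. real measurable functions on \<open>'s \<times> full_support\<close> (curried). The
  values outside \<open>full_support\<close> are left unconstrained; only \<open>\<psi>(\<cdot>, m T0)\<close> for a flow \<open>m\<close> with
  full support is evaluated.
\<close>

definition terminal_payoffs :: "('s::finite \<Rightarrow> 's pmf \<Rightarrow> real) set" where
  "terminal_payoffs =
     {\<psi>. case_prod \<psi> \<in> borel_measurable (count_space UNIV \<Otimes>\<^sub>M restrict_space borel_pmf full_support)}"

end

theory Submission
  imports Defs
begin

text \<open>
  Both inclusions rest on the tower property: the cost over \<open>{t..T}\<close> is the cost over \<open>{t..T0}\<close>
  with the remaining cost as terminal payoff. For \<open>\<supseteq>\<close>, follow \<open>\<alpha>\<close> up to \<open>T0\<close> and then an almost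
  optimal control of the game restarted at \<open>T0\<close>; the errors add up to at most \<open>4 * \<epsilon>\<close>. For \<open>\<subseteq>\<close>,
  let \<open>\<psi>\<close> be the remaining cost of the equilibrium \<open>\<alpha>\<close> itself, taken constant in the measure
  argument. To see that \<open>\<alpha>\<close> is almost optimal after \<open>T0\<close> at a state \<open>x0\<close>, compare it with any
  \<open>\<beta>\<close>: the control picking at each time and state the one of \<open>\<alpha>\<close> and \<open>\<beta>\<close> with the smaller
  remaining cost is at least as good as both everywhere. Switching to it at time \<open>T0\<close> gains at
  least \<open>c\<^sub>q\<close> times the gain at \<open>x0\<close>, because \<open>x0\<close> is reached with probability at least \<open>c\<^sub>q\<close>.
\<close>

section \<open>Flows of marginals\<close>

lemma mf_flow_start: "mf_flow T q t \<mu> \<alpha> t = \<mu>"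
  by (simp add: mf_flow_def mf_law_def path_law_initial)

text \<open>Later transitions leave earlier coordinates alone, so each marginal can be read off a
  path law cut at its own time. The McKean--Vlasov law thus reduces to a deterministic recursion,
  the basis of the flow lemmas below.\<close>

lemma mf_flow_Suc:
  assumes "t \<le> s" "s < T"
  shows "mf_flow T q t \<mu> \<alpha> (Suc s)
    = bind_pmf (mf_flow T q t \<mu> \<alpha> s) (\<lambda>x. q s x (mf_flow T q t \<mu> \<alpha> s) (\<alpha> s x))"
proof -
  define \<kappa> where "\<kappa> = (\<lambda>s \<nu> x. q s x \<nu> (\<alpha> s x))"
  define n where "n = s - t"
  have s: "s = t + n" using assms by (simp add: n_def)
  obtain k where k: "T - t = Suc n + k"
    using assms by (metis Suc_leI diff_less_mono le_Suc_ex n_def)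
  have k': "T - t = n + Suc k" using k by simp
  have 1: "mf_flow T q t \<mu> \<alpha> (Suc s) = map_pmf (\<lambda>w. w (Suc s)) (path_law \<kappa> t \<mu> (Suc n))"
    unfolding mf_flow_def mf_law_def \<kappa>_def[symmetric] k
    by (rule path_law_extend) (simp add: s)
  have 2: "mf_flow T q t \<mu> \<alpha> s = map_pmf (\<lambda>w. w s) (path_law \<kappa> t \<mu> n)"
    unfolding mf_flow_def mf_law_def \<kappa>_def[symmetric] k'
    by (rule path_law_extend) (simp add: s)
  show ?thesis
    unfolding 1 2
    by (simp add: map_bind_pmf bind_map_pmf pmf.map_comp o_def s \<kappa>_def)
qed

lemma mf_flow_cong:
  assumes "\<And>s. t \<le> s \<Longrightarrow> s < T0 \<Longrightarrow> \<alpha> s = \<beta> s" "t \<le> s" "s \<le> T0" "T0 \<le> T"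
  shows "mf_flow T q t \<mu> \<alpha> s = mf_flow T q t \<mu> \<beta> s"
  using assms(2,3)
proof (induction s rule: dec_induct)
  case base
  show ?case by (simp add: mf_flow_start)
next
  case (step s)
  then show ?case using assms by (simp add: mf_flow_Suc)
qed

text \<open>Each marginal is computed from the previous marginal alone, which gives the semigroup
  property of the flow.\<close>

lemma mf_flow_restart:
  assumes "t \<le> T0" "T0 \<le> s" "s \<le> T"
  shows "mf_flow T q T0 (mf_flow T q t \<mu> \<alpha> T0) \<alpha> s = mf_flow T q t \<mu> \<alpha> s"
  using assms(2,3)
proof (induction s rule: dec_induct)
  case base
  show ?case by (simp add: mf_flow_start)
next
  case (step s)
  then show ?case using assms by (simp add: mf_flow_Suc)
qed

section \<open>The cost as an iterated operator\<close>

text \<open>The dynamic programming operator of a single player in a frozen flow \<open>m\<close>,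
  for a fixed control in place of a minimum over actions.\<close>

definition step ::
  "(nat \<Rightarrow> 's::finite \<Rightarrow> 's pmf \<Rightarrow> 'a \<Rightarrow> 's pmf) \<Rightarrow> (nat \<Rightarrow> 's \<Rightarrow> 's pmf \<Rightarrow> 'a \<Rightarrow> real) \<Rightarrow>
   (nat \<Rightarrow> 's pmf) \<Rightarrow> (nat \<Rightarrow> 's \<Rightarrow> 'a) \<Rightarrow> nat \<Rightarrow> ('s \<Rightarrow> real) \<Rightarrow> 's \<Rightarrow> real" where
  "step q F m \<alpha> s g x =
     F s x (m s) (\<alpha> s x) + (\<Sum>y\<in>UNIV. pmf (q s x (m s) (\<alpha> s x)) y * g y)"

primrec cost ::
  "(nat \<Rightarrow> 's::finite \<Rightarrow> 's pmf \<Rightarrow> 'a \<Rightarrow> 's pmf) \<Rightarrow> (nat \<Rightarrow> 's \<Rightarrow> 's pmf \<Rightarrow> 'a \<Rightarrow> real) \<Rightarrow>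
   (nat \<Rightarrow> 's pmf) \<Rightarrow> (nat \<Rightarrow> 's \<Rightarrow> 'a) \<Rightarrow> nat \<Rightarrow> nat \<Rightarrow> ('s \<Rightarrow> real) \<Rightarrow> 's \<Rightarrow> real" where
  "cost q F m \<alpha> t 0 g = g"
| "cost q F m \<alpha> t (Suc n) g = step q F m \<alpha> t (cost q F m \<alpha> (Suc t) n g)"

lemma sum_pmf_UNIV: "(\<Sum>y\<in>UNIV. pmf p y) = 1" for p :: "'s::finite pmf"
  by (rule sum_pmf_eq_1) auto

lemma step_mono:
  assumes "\<And>y. g y \<le> h y"
  shows "step q F m \<alpha> s g x \<le> step q F m \<alpha> s h x"
  unfolding step_def by (intro add_left_mono sum_mono mult_left_mono assms pmf_nonneg)

lemma step_add_const: "step q F m \<alpha> s (\<lambda>y. g y + c) x = step q F m \<alpha> s g x + c"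
  by (simp add: step_def distrib_left sum.distrib sum_pmf_UNIV flip: sum_distrib_right)

lemma cost_mono:
  assumes "\<And>y. g y \<le> h y"
  shows "cost q F m \<alpha> t n g x \<le> cost q F m \<alpha> t n h x"
  by (induction n arbitrary: t x) (simp_all add: assms step_mono)

lemma cost_add_const: "cost q F m \<alpha> t n (\<lambda>y. g y + c) x = cost q F m \<alpha> t n g x + c"
proof (induction n arbitrary: t x)
  case (Suc n)
  show ?case by (simp add: Suc.IH[abs_def] step_add_const)
qed simp

text \<open>Being monotone and commuting with constants, the operator does not amplify errors: a
  bound on the terminal payoff passes unchanged to the initial time.\<close>

lemma cost_le_add_const:
  assumes "\<And>y. g y \<le> h y + c"
  shows "cost q F m \<alpha> t n g x \<le> cost q F m \<alpha> t n h x + c"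
  using cost_mono[of g "\<lambda>y. h y + c", OF assms] by (simp add: cost_add_const)

lemma cost_cong:
  assumes "\<And>s. t \<le> s \<Longrightarrow> s < t + n \<Longrightarrow> m s = m' s" "\<And>s. t \<le> s \<Longrightarrow> s < t + n \<Longrightarrow> \<alpha> s = \<beta> s"
  shows "cost q F m \<alpha> t n g = cost q F m' \<beta> t n g"
  using assms
proof (induction n arbitrary: t)
  case (Suc n)
  have "cost q F m \<alpha> (Suc t) n g = cost q F m' \<beta> (Suc t) n g"
    by (rule Suc.IH) (auto intro: Suc.prems)
  then show ?case
    using Suc.prems[of t] by (auto simp: step_def)
qed simp

lemma cost_add: "cost q F m \<alpha> t (n + k) g = cost q F m \<alpha> t n (cost q F m \<alpha> (t + n) k g)"
  by (induction n arbitrary: t) simp_all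

lemma cost_Suc_right: "cost q F m \<alpha> t (Suc n) g = cost q F m \<alpha> t n (step q F m \<alpha> (t + n) g)"
  using cost_add[of q F m \<alpha> t n 1 g] by simp

lemma finite_set_path_law: "finite (set_pmf (path_law \<kappa> t (\<mu> :: 's::finite pmf) n))"
  by (induction n) auto

text \<open>Links expected costs to the iterated operator. The horizon \<open>N\<close> may exceed
  \<open>n\<close> because the laws always run to \<open>T\<close>, while truncated costs stop at
  \<open>T0\<close>.\<close>

lemma expectation_path_law:
  assumes "n \<le> N"
  shows "measure_pmf.expectation
      (path_law (\<lambda>s _ y. q s y (m s) (\<alpha> s y)) t (return_pmf (x :: 's::finite)) N)
      (\<lambda>w. g (w (t + n)) + (\<Sum>r = t..<t + n. F r (w r) (m r) (\<alpha> r (w r))))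
    = cost q F m \<alpha> t n g x"
proof -
  define P where "P = path_law (\<lambda>s _ y. q s y (m s) (\<alpha> s y)) t (return_pmf x)"
  define c where "c = (\<lambda>n w. \<Sum>r = t..<t + n. F r (w r) (m r) (\<alpha> r (w r)))"
  have c_upd: "c n (w(i := y)) = c n w" if "i \<ge> t + n" for n w i y
    unfolding c_def using that by (intro sum.cong) auto
  have "measure_pmf.expectation (P n) (\<lambda>w. g (w (t + n)) + c n w) = cost q F m \<alpha> t n g x"
  \<comment> \<open>Conditioning on the path up to \<open>t + n\<close> absorbs the last transition
    into the payoff, so the hypothesis is applied to \<open>step\<close> of
    \<open>g\<close>.\<close>
  proof (induction n arbitrary: g)
    case 0
    show ?case by (simp add: P_def c_def)
  next
    case (Suc n)
    let ?K = "\<lambda>w. q (t + n) (w (t + n)) (m (t + n)) (\<alpha> (t + n) (w (t + n)))"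
    have fin: "finite (set_pmf (P n))"
      by (simp add: P_def finite_set_path_law)
    have "measure_pmf.expectation (P (Suc n)) (\<lambda>w. g (w (t + Suc n)) + c (Suc n) w)
      = (\<Sum>w\<in>set_pmf (P n). pmf (P n) w *\<^sub>R measure_pmf.expectation
          (map_pmf (\<lambda>y. w(Suc (t + n) := y)) (?K w)) (\<lambda>w. g (w (t + Suc n)) + c (Suc n) w))"
      unfolding P_def path_law.simps
      by (rule pmf_expectation_bind) (auto simp: finite_set_path_law)
    also have "\<dots> = (\<Sum>w\<in>set_pmf (P n). pmf (P n) w *\<^sub>R
        (step q F m \<alpha> (t + n) g (w (t + n)) + c n w))"
    proof (intro sum.cong refl arg_cong[where f = "scaleR _"])
      fix w
      have "measure_pmf.expectation (map_pmf (\<lambda>y. w(Suc (t + n) := y)) (?K w))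
          (\<lambda>w. g (w (t + Suc n)) + c (Suc n) w)
        = (\<Sum>y\<in>UNIV. pmf (?K w) y * (g y + c (Suc n) w))"
        by (simp add: c_upd integral_measure_pmf_real[where A = UNIV] mult.commute)
      also have "\<dots> = (\<Sum>y\<in>UNIV. pmf (?K w) y * g y) + c (Suc n) w"
        by (simp add: distrib_left sum.distrib sum_pmf_UNIV flip: sum_distrib_right)
      also have "\<dots> = step q F m \<alpha> (t + n) g (w (t + n)) + c n w"
        by (simp add: step_def c_def)
      finally show "measure_pmf.expectation (map_pmf (\<lambda>y. w(Suc (t + n) := y)) (?K w))
          (\<lambda>w. g (w (t + Suc n)) + c (Suc n) w)
        = step q F m \<alpha> (t + n) g (w (t + n)) + c n w" .
    qed
    also have "\<dots> = measure_pmf.expectation (P n)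
        (\<lambda>w. step q F m \<alpha> (t + n) g (w (t + n)) + c n w)"
      using fin by (subst integral_measure_pmf[where A = "set_pmf (P n)"]) auto
    also have "\<dots> = cost q F m \<alpha> t (Suc n) g x"
      unfolding Suc.IH cost_Suc_right ..
    finally show ?case .
  qed
  moreover have "map_pmf (\<lambda>w. g (w (t + n)) + c n w) (P N)
    = map_pmf (\<lambda>w. g (w (t + n)) + c n w) (P n)"
    using path_law_extend[of t n "\<lambda>w. g (w (t + n)) + c n w" _ "return_pmf x" "N - n"] assms
    by (simp add: P_def c_upd)
  \<comment> \<open>Integrating the identity against equal image laws gives equal
    expectations.\<close>
  then have "measure_pmf.expectation (P N) (\<lambda>w. g (w (t + n)) + c n w)
    = measure_pmf.expectation (P n) (\<lambda>w. g (w (t + n)) + c n w)"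
    by (auto dest: arg_cong[where f = "\<lambda>p. measure_pmf.expectation p (\<lambda>r. r)"])
  ultimately show ?thesis by (simp add: P_def c_def)
qed

lemma J_flow_eq_cost:
  assumes "t \<le> T"
  shows "J_flow T q F G m t x \<alpha> = cost q F m \<alpha> t (T - t) (\<lambda>y. G y (m T)) x"
  using expectation_path_law[of "T - t" "T - t" q m \<alpha> t x "\<lambda>y. G y (m T)" F] assms
  by (simp add: J_flow_def flow_law_def)

lemma J_trunc_eq_cost:
  fixes \<mu> :: "'s::finite pmf" and T q t \<alpha>
  defines "m \<equiv> mf_flow T q t \<mu> \<alpha>"
  assumes "t \<le> T0" "T0 \<le> T"
  shows "J_trunc T q F T0 \<psi> t \<mu> \<alpha> x \<beta> = cost q F m \<beta> t (T0 - t) (\<lambda>y. \<psi> y (m T0)) x"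
  using expectation_path_law[of "T0 - t" "T - t" q m \<beta> t x "\<lambda>y. \<psi> y (m T0)" F] assms
  by (simp add: J_trunc_def flow_law_def Let_def)

lemma J_flow_cong:
  fixes m m' :: "nat \<Rightarrow> 's::finite pmf"
  assumes "t \<le> T" "\<And>s. t \<le> s \<Longrightarrow> s \<le> T \<Longrightarrow> m s = m' s" "\<And>s. t \<le> s \<Longrightarrow> s < T \<Longrightarrow> \<alpha> s = \<beta> s"
  shows "J_flow T q F G m t x \<alpha> = J_flow T q F G m' t x \<beta>"
  using assms cost_cong[of t "T - t" m m' \<alpha> \<beta> q F] by (simp add: J_flow_eq_cost)

lemma J_flow_tower:
  assumes "t \<le> T0" "T0 \<le> T"
  shows "J_flow T q F G m t x \<alpha> = cost q F m \<alpha> t (T0 - t) (\<lambda>y. J_flow T q F G m T0 y \<alpha>) x"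
proof -
  have "cost q F m \<alpha> t (T - t) g = cost q F m \<alpha> t (T0 - t) (cost q F m \<alpha> T0 (T - T0) g)" for g
    using cost_add[of q F m \<alpha> t "T0 - t" "T - T0" g] assms by simp
  then show ?thesis
    using assms by (simp add: J_flow_eq_cost)
qed

section \<open>Concatenation and improvement of controls\<close>

text \<open>The second control already acts at \<open>T0\<close>, since running costs up to
  \<open>T0\<close> involve only actions strictly before it.\<close>

definition concat_controls :: "nat \<Rightarrow> (nat \<Rightarrow> 'b) \<Rightarrow> (nat \<Rightarrow> 'b) \<Rightarrow> nat \<Rightarrow> 'b" where
  "concat_controls T0 \<alpha> \<beta> s = (if s < T0 then \<alpha> s else \<beta> s)"

lemma concat_controls_mem:
  "\<alpha> \<in> controls T A \<Longrightarrow> \<beta> \<in> controls T A \<Longrightarrow> concat_controls T0 \<alpha> \<beta> \<in> controls T A"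
  by (auto simp: controls_def concat_controls_def)

text \<open>Here only the individual player switches controls; the flow \<open>m\<close> stays
  fixed.\<close>

lemma J_flow_concat:
  assumes "t \<le> T0" "T0 \<le> T"
  shows "J_flow T q F G m t x (concat_controls T0 \<alpha> \<beta>)
    = cost q F m \<alpha> t (T0 - t) (\<lambda>y. J_flow T q F G m T0 y \<beta>) x"
proof -
  have "J_flow T q F G m T0 y (concat_controls T0 \<alpha> \<beta>) = J_flow T q F G m T0 y \<beta>" for y
    using assms by (intro J_flow_cong) (auto simp: concat_controls_def)
  moreover have "cost q F m (concat_controls T0 \<alpha> \<beta>) t (T0 - t) = cost q F m \<alpha> t (T0 - t)"
    by (intro ext fun_cong[OF cost_cong]) (auto simp: concat_controls_def)
  ultimately show ?thesis
    using assms by (simp add: J_flow_tower[of t T0])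
qed

lemma mf_flow_concat_before:
  assumes "t \<le> s" "s \<le> T0" "T0 \<le> T"
  shows "mf_flow T q t \<mu> (concat_controls T0 \<alpha> \<beta>) s = mf_flow T q t \<mu> \<alpha> s"
  using assms by (intro mf_flow_cong[of t T0]) (auto simp: concat_controls_def)

lemma mf_flow_concat_after:
  assumes "t \<le> T0" "T0 \<le> s" "s \<le> T"
  shows "mf_flow T q t \<mu> (concat_controls T0 \<alpha> \<beta>) s
    = mf_flow T q T0 (mf_flow T q t \<mu> \<alpha> T0) \<beta> s"
proof -
  let ?\<gamma> = "concat_controls T0 \<alpha> \<beta>"
  have "mf_flow T q t \<mu> ?\<gamma> s = mf_flow T q T0 (mf_flow T q t \<mu> ?\<gamma> T0) ?\<gamma> s"
    using assms by (simp add: mf_flow_restart)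
  also have "\<dots> = mf_flow T q T0 (mf_flow T q t \<mu> \<alpha> T0) ?\<gamma> s"
    using assms by (simp add: mf_flow_concat_before)
  also have "\<dots> = mf_flow T q T0 (mf_flow T q t \<mu> \<alpha> T0) \<beta> s"
    using assms by (intro mf_flow_cong[of T0 s]) (auto simp: concat_controls_def)
  finally show ?thesis .
qed

lemma J_restart:
  fixes q :: "nat \<Rightarrow> 's::finite \<Rightarrow> 's pmf \<Rightarrow> 'a \<Rightarrow> 's pmf"
  assumes "t \<le> T0" "T0 \<le> T"
  shows "J T q F G T0 (mf_flow T q t \<mu> \<alpha> T0) \<alpha> y \<beta> = J_flow T q F G (mf_flow T q t \<mu> \<alpha>) T0 y \<beta>"
  unfolding J_def using assms by (intro J_flow_cong) (auto simp: mf_flow_restart)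

text \<open>Here the population switches at \<open>T0\<close>, so after \<open>T0\<close> the player
  faces the flow of \<open>\<alpha>'\<close> restarted from the marginal of
  \<open>\<alpha>\<close>.\<close>

lemma J_concat:
  fixes q :: "nat \<Rightarrow> 's::finite \<Rightarrow> 's pmf \<Rightarrow> 'a \<Rightarrow> 's pmf"
  assumes "t \<le> T0" "T0 \<le> T"
  shows "J T q F G t \<mu> (concat_controls T0 \<alpha> \<alpha>') x \<beta>
    = cost q F (mf_flow T q t \<mu> \<alpha>) \<beta> t (T0 - t)
        (\<lambda>y. J T q F G T0 (mf_flow T q t \<mu> \<alpha> T0) \<alpha>' y \<beta>) x"
proof -
  let ?m = "mf_flow T q t \<mu> (concat_controls T0 \<alpha> \<alpha>')"
  have "J_flow T q F G ?m T0 y \<beta> = J T q F G T0 (mf_flow T q t \<mu> \<alpha> T0) \<alpha>' y \<beta>" for y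
    unfolding J_def using assms by (intro J_flow_cong) (auto simp: mf_flow_concat_after)
  moreover have "cost q F ?m \<beta> t (T0 - t) = cost q F (mf_flow T q t \<mu> \<alpha>) \<beta> t (T0 - t)"
    using assms by (intro ext fun_cong[OF cost_cong]) (auto intro: mf_flow_concat_before)
  ultimately show ?thesis
    using assms by (simp add: J_def J_flow_tower[of t T0])
qed

text \<open>Policy improvement by backward induction. A deviation good at one state may be worse
  than \<open>\<alpha>\<close> at others and lose its gain on average; the improved control is
  nowhere worse than \<open>\<alpha>\<close>.\<close>

lemma exists_common_improvement:
  fixes q :: "nat \<Rightarrow> 's::finite \<Rightarrow> 's pmf \<Rightarrow> 'a \<Rightarrow> 's pmf"
  assumes "\<alpha> \<in> controls T A" "\<beta> \<in> controls T A" "t \<le> T"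
  obtains \<gamma> where "\<gamma> \<in> controls T A"
    "\<And>x. J_flow T q F G m t x \<gamma> \<le> J_flow T q F G m t x \<alpha>"
    "\<And>x. J_flow T q F G m t x \<gamma> \<le> J_flow T q F G m t x \<beta>"
proof -
  define C where "C = (\<lambda>\<alpha> s. cost q F m \<alpha> s (T - s) (\<lambda>y. G y (m T)))"
  define \<gamma> where "\<gamma> = (\<lambda>s x. if C \<alpha> s x \<le> C \<beta> s x then \<alpha> s x else \<beta> s x)"
  have C_step: "C \<delta> s = step q F m \<delta> s (C \<delta> (Suc s))" if "s < T" for \<delta> s
    using that by (simp add: C_def Suc_diff_Suc flip: cost.simps(2))
  have "C \<gamma> s x \<le> min (C \<alpha> s x) (C \<beta> s x)" if "s \<le> T" for s x
    using that
  proof (induction s arbitrary: x rule: inc_induct)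
    case base
    show ?case by (simp add: C_def)
  next
    case (step s)
    \<comment> \<open>By induction, continuing with \<open>\<gamma>\<close> after \<open>s\<close>
      costs no more than continuing with \<open>\<alpha>\<close> or with \<open>\<beta>\<close>;
      \<open>\<gamma>\<close> then takes the action at \<open>s\<close> whose bound is
      smaller.\<close>
    have \<alpha>: "step q F m \<alpha> s (C \<gamma> (Suc s)) x \<le> C \<alpha> s x"
      unfolding C_step[OF step.hyps(2)] using step.IH by (intro step_mono) force
    have \<beta>: "step q F m \<beta> s (C \<gamma> (Suc s)) x \<le> C \<beta> s x"
      unfolding C_step[OF step.hyps(2)] using step.IH by (intro step_mono) force
    have "C \<gamma> s x = step q F m (if C \<alpha> s x \<le> C \<beta> s x then \<alpha> else \<beta>) s (C \<gamma> (Suc s)) x"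
      unfolding C_step[OF step.hyps(2), of \<gamma>] by (simp add: step_def \<gamma>_def)
    with \<alpha> \<beta> show ?case by (auto split: if_splits)
  qed
  then show thesis
    using assms by (intro that[of \<gamma>]) (auto simp: C_def J_flow_eq_cost controls_def \<gamma>_def)
qed

text \<open>Since \<open>m\<close> is fixed and there are finitely many states, the pointwise lower
  bounds of \<open>F\<close> can be minimised over states and summed over times. This makes the real
  infima in the equilibrium conditions genuine.\<close>

lemma bdd_below_cost:
  assumes F_bdd: "\<And>s x \<nu>. s \<le> T \<Longrightarrow> bdd_below (F s x \<nu> ` A)" and "t + n \<le> T"
  shows "bdd_below ((\<lambda>\<alpha>. cost q F m \<alpha> t n g x) ` controls T A)"
proof -
  \<comment> \<open>The bound must be uniform in \<open>x\<close>, because the preceding step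
    averages over states.\<close>
  have "\<exists>b. \<forall>\<alpha>\<in>controls T A. \<forall>x. b \<le> cost q F m \<alpha> t n g x"
    using assms(2)
  proof (induction n arbitrary: t)
    case 0
    have "Min (range g) \<le> g x" for x by simp
    then have "\<exists>b. \<forall>x. b \<le> g x" by blast
    then show ?case by simp
  next
    case (Suc n)
    from Suc obtain b where b: "\<And>\<alpha> x. \<alpha> \<in> controls T A \<Longrightarrow> b \<le> cost q F m \<alpha> (Suc t) n g x"
      by (metis add_Suc add_Suc_right)
    have "\<exists>l. \<forall>a\<in>A. l \<le> F t x (m t) a" for x
      using F_bdd[of t x "m t"] Suc.prems by (auto simp: bdd_below_def)
    then obtain l where l: "\<And>x a. a \<in> A \<Longrightarrow> l x \<le> F t x (m t) a"
      by metis
    have "Min (range l) + b \<le> cost q F m \<alpha> t (Suc n) g x" if \<alpha>: "\<alpha> \<in> controls T A" for \<alpha> x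
    proof -
      have "Min (range l) \<le> F t x (m t) (\<alpha> t x)"
        using \<alpha> Suc.prems by (intro order_trans[OF Min_le l]) (auto simp: controls_def)
      then have "Min (range l) + b \<le> step q F m \<alpha> t (\<lambda>_. b) x"
        by (simp add: step_def sum_pmf_UNIV flip: sum_distrib_right)
      also have "\<dots> \<le> cost q F m \<alpha> t (Suc n) g x"
        using b[OF \<alpha>] by (simp add: step_mono)
      finally show ?thesis .
    qed
    then show ?case by blast
  qed
  then show ?thesis by (auto simp: bdd_below_def)
qed

text \<open>From every state the last transition before \<open>T0\<close> hits \<open>z\<close> with
  probability at least \<open>c\<close>, so the saving at \<open>z\<close> counts at least
  \<open>c\<close> times; the earlier steps pass this constant on.\<close>

lemma cost_gap:
  assumes q_ge: "\<And>s x \<nu> a y. s \<le> T \<Longrightarrow> a \<in> A \<Longrightarrow> pmf (q s x \<nu> a) y \<ge> c"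
    and \<alpha>: "\<alpha> \<in> controls T A" and "t < T0" "T0 \<le> T" and hg: "\<And>y. h y \<le> g y"
  shows "cost q F m \<alpha> t (T0 - t) h x + c * (g z - h z) \<le> cost q F m \<alpha> t (T0 - t) g x"
proof -
  \<comment> \<open>\<open>t + n\<close> is the last time before \<open>T0\<close>; it exists
    because \<open>t < T0\<close>.\<close>
  define n where "n = T0 - Suc t"
  have n: "T0 - t = Suc n" "t + n \<le> T" using assms by (auto simp: n_def)
  have "step q F m \<alpha> (t + n) h y + c * (g z - h z) \<le> step q F m \<alpha> (t + n) g y" for y
  proof -
    let ?p = "pmf (q (t + n) y (m (t + n)) (\<alpha> (t + n) y))"
    have "c * (g z - h z) \<le> ?p z * (g z - h z)"
      using \<alpha> n hg by (intro mult_right_mono q_ge) (auto simp: controls_def)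
    \<comment> \<open>All other summands are nonnegative because \<open>h\<close> lies below
      \<open>g\<close> everywhere.\<close>
    also have "\<dots> \<le> (\<Sum>y\<in>UNIV. ?p y * (g y - h y))"
      using hg by (intro member_le_sum) auto
    also have "\<dots> = step q F m \<alpha> (t + n) g y - step q F m \<alpha> (t + n) h y"
      by (simp add: step_def right_diff_distrib sum_subtractf)
    finally show ?thesis by simp
  qed
  then show ?thesis
    unfolding n(1) cost_Suc_right cost_add_const[symmetric] by (intro cost_mono)
qed

section \<open>Approximate equilibria\<close>

lemma sup_norm_le_iff: "sup_norm f \<le> e \<longleftrightarrow> (\<forall>x :: 's::finite. \<bar>f x\<bar> \<le> e)"
  unfolding sup_norm_def by (subst cSUP_le_iff) auto

lemma le_cINF_add_iff:
  fixes f :: "'b \<Rightarrow> real"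
  assumes "bdd_below (f ` C)" "C \<noteq> {}"
  shows "a \<le> (INF b\<in>C. f b) + e \<longleftrightarrow> (\<forall>b\<in>C. a \<le> f b + e)"
  using le_cINF_iff[OF assms(2,1), of "a - e"] by (simp add: diff_le_eq)

text \<open>Boundedness below turns near-optimality against an infimum into a comparison with each
  single deviation, the form used from here on.\<close>

lemma M_state_iff:
  fixes q :: "nat \<Rightarrow> 's::finite \<Rightarrow> 's pmf \<Rightarrow> 'a \<Rightarrow> 's pmf"
  assumes F_bdd: "\<And>s x \<nu>. s \<le> T \<Longrightarrow> bdd_below (F s x \<nu> ` A)" and "t \<le> T"
  shows "\<alpha> \<in> M_state T A q F G \<epsilon> t \<mu> \<longleftrightarrow> \<alpha> \<in> controls T A \<and>
    (\<forall>x. \<forall>\<beta>\<in>controls T A. J T q F G t \<mu> \<alpha> x \<alpha> \<le> J T q F G t \<mu> \<alpha> x \<beta> + \<epsilon>)"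
proof -
  have "bdd_below (J_flow T q F G m t x ` controls T A)" for m x
    using bdd_below_cost[of T F A t "T - t", OF F_bdd] \<open>t \<le> T\<close> by (simp add: J_flow_eq_cost)
  \<comment> \<open>\<open>conj_cong\<close> makes the membership of \<open>\<alpha>\<close>
    available, so the infimum is over a nonempty set.\<close>
  then show ?thesis
    unfolding M_state_def v_flow_def J_def mem_Collect_eq
    by (intro conj_cong refl all_cong1 le_cINF_add_iff) auto
qed

lemma M_trunc_iff:
  fixes q :: "nat \<Rightarrow> 's::finite \<Rightarrow> 's pmf \<Rightarrow> 'a \<Rightarrow> 's pmf"
  assumes F_bdd: "\<And>s x \<nu>. s \<le> T \<Longrightarrow> bdd_below (F s x \<nu> ` A)" and "t \<le> T0" "T0 \<le> T"
  shows "\<alpha> \<in> M_trunc T A q F \<epsilon> T0 \<psi> t \<mu> \<longleftrightarrow> \<alpha> \<in> controls T A \<and>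
    (\<forall>x. \<forall>\<beta>\<in>controls T A. J_trunc T q F T0 \<psi> t \<mu> \<alpha> x \<alpha> \<le> J_trunc T q F T0 \<psi> t \<mu> \<alpha> x \<beta> + \<epsilon>)"
proof -
  have "bdd_below (J_trunc T q F T0 \<psi> t \<mu> \<alpha> x ` controls T A)" for x
    using bdd_below_cost[of T F A t "T0 - t", OF F_bdd] assms(2,3) by (simp add: J_trunc_eq_cost)
  then show ?thesis
    unfolding M_trunc_def mem_Collect_eq
    by (intro conj_cong refl all_cong1 le_cINF_add_iff) auto
qed

text \<open>A saving above \<open>\<delta>\<close> at \<open>z\<close> after \<open>T0\<close> would
  save more than \<open>c * \<delta> \<ge> \<epsilon>\<close> at time \<open>t\<close>, against the
  equilibrium property. The flow is unchanged because only one player deviates.\<close>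

lemma M_state_restart:
  fixes q :: "nat \<Rightarrow> 's::finite \<Rightarrow> 's pmf \<Rightarrow> 'a \<Rightarrow> 's pmf"
  assumes F_bdd: "\<And>s x \<nu>. s \<le> T \<Longrightarrow> bdd_below (F s x \<nu> ` A)"
    and q_ge: "\<And>s x \<nu> a y. s \<le> T \<Longrightarrow> a \<in> A \<Longrightarrow> pmf (q s x \<nu> a) y \<ge> c"
    and c: "c > 0" and times: "t < T0" "T0 \<le> T"
    and \<alpha>: "\<alpha> \<in> M_state T A q F G \<epsilon> t \<mu>" and \<epsilon>: "\<epsilon> \<le> c * \<delta>"
  shows "\<alpha> \<in> M_state T A q F G \<delta> T0 (mf_flow T q t \<mu> \<alpha> T0)"
proof -
  define m where "m = mf_flow T q t \<mu> \<alpha>"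
  have \<alpha>_ctrl: "\<alpha> \<in> controls T A"
    and \<alpha>_opt: "\<And>x \<beta>. \<beta> \<in> controls T A \<Longrightarrow> J_flow T q F G m t x \<alpha> \<le> J_flow T q F G m t x \<beta> + \<epsilon>"
    using \<alpha> times by (auto simp: M_state_iff[of T F A t, OF F_bdd] J_def m_def)
  have "J_flow T q F G m T0 z \<alpha> \<le> J_flow T q F G m T0 z \<beta> + \<delta>" if \<beta>: "\<beta> \<in> controls T A" for z \<beta>
  proof -
    obtain \<gamma> where \<gamma>: "\<gamma> \<in> controls T A"
        "\<And>x. J_flow T q F G m T0 x \<gamma> \<le> J_flow T q F G m T0 x \<alpha>"
        "\<And>x. J_flow T q F G m T0 x \<gamma> \<le> J_flow T q F G m T0 x \<beta>"
      using exists_common_improvement[OF \<alpha>_ctrl \<beta> times(2)] by metis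
    \<comment> \<open>The game is started at \<open>z\<close> merely for definiteness: from any
      initial state, \<open>z\<close> is hit at \<open>T0\<close> with probability at least
      \<open>c\<close>.\<close>
    define C where "C = (\<lambda>g. cost q F m \<alpha> t (T0 - t) g z)"
    let ?g = "\<lambda>y. J_flow T q F G m T0 y \<alpha>" and ?h = "\<lambda>y. J_flow T q F G m T0 y \<gamma>"
    have "C ?h + c * (?g z - ?h z) \<le> C ?g"
      unfolding C_def by (rule cost_gap[OF q_ge \<alpha>_ctrl times \<gamma>(2)])
    also have "C ?g = J_flow T q F G m t z \<alpha>"
      using times by (simp add: C_def J_flow_tower[of t T0])
    also have "\<dots> \<le> J_flow T q F G m t z (concat_controls T0 \<alpha> \<gamma>) + \<epsilon>"
      by (intro \<alpha>_opt concat_controls_mem \<alpha>_ctrl \<gamma>)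
    also have "\<dots> = C ?h + \<epsilon>"
      using times by (simp add: C_def J_flow_concat)
    finally have "c * (?g z - ?h z) \<le> c * \<delta>" using \<epsilon> by simp
    then show ?thesis using c \<gamma>(3)[of z] by simp
  qed
  then show ?thesis
    using times \<alpha>_ctrl by (simp add: M_state_iff[of T F A T0, OF F_bdd] J_restart m_def)
qed

lemma const_terminal_payoff: "(\<lambda>x _. f x) \<in> terminal_payoffs"
proof -
  have "(\<lambda>p. f (fst p)) \<in> borel_measurable (count_space UNIV \<Otimes>\<^sub>M restrict_space borel_pmf full_support)"
    by (rule measurable_compose[OF measurable_fst]) simp
  then show ?thesis
    by (simp add: terminal_payoffs_def case_prod_beta')
qed

text \<open>The bound \<open>\<epsilon>' \<le> c * \<epsilon>\<close> pays for the restart at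
  \<open>T0\<close>; \<open>\<epsilon>' \<le> \<epsilon>\<close> covers the truncated game and the
  distance to \<open>\<phi>\<close>.\<close>

lemma V_state_eps_split:
  fixes q :: "nat \<Rightarrow> 's::finite \<Rightarrow> 's pmf \<Rightarrow> 'a \<Rightarrow> 's pmf"
  assumes F_bdd: "\<And>s x \<nu>. s \<le> T \<Longrightarrow> bdd_below (F s x \<nu> ` A)"
    and q_ge: "\<And>s x \<nu> a y. s \<le> T \<Longrightarrow> a \<in> A \<Longrightarrow> pmf (q s x \<nu> a) y \<ge> c"
    and c: "c > 0" and times: "t < T0" "T0 \<le> T"
    and \<phi>: "\<phi> \<in> V_state_eps T A q F G \<epsilon>' t \<mu>" and \<epsilon>: "\<epsilon>' \<le> c * \<epsilon>" "\<epsilon>' \<le> \<epsilon>" "0 \<le> \<epsilon>"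
  shows "\<exists>\<psi>\<in>terminal_payoffs. \<exists>\<alpha>\<in>controls T A.
    (\<lambda>x. \<psi> x (mf_flow T q t \<mu> \<alpha> T0)) \<in> V_state_eps T A q F G \<epsilon> T0 (mf_flow T q t \<mu> \<alpha> T0) \<and>
    \<alpha> \<in> M_trunc T A q F \<epsilon> T0 \<psi> t \<mu> \<and>
    sup_norm (\<lambda>x. \<phi> x - J_trunc T q F T0 \<psi> t \<mu> \<alpha> x \<alpha>) \<le> \<epsilon>"
proof -
  from \<phi> obtain \<alpha> where \<alpha>: "\<alpha> \<in> M_state T A q F G \<epsilon>' t \<mu>"
    and \<phi>_le: "\<And>x. \<bar>\<phi> x - J T q F G t \<mu> \<alpha> x \<alpha>\<bar> \<le> \<epsilon>'"
    by (auto simp: V_state_eps_def sup_norm_le_iff)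
  have \<alpha>_ctrl: "\<alpha> \<in> controls T A"
    and \<alpha>_opt: "\<And>x \<beta>. \<beta> \<in> controls T A \<Longrightarrow> J T q F G t \<mu> \<alpha> x \<alpha> \<le> J T q F G t \<mu> \<alpha> x \<beta> + \<epsilon>'"
    using \<alpha> times by (auto simp: M_state_iff[of T F A t, OF F_bdd])
  define \<nu> where "\<nu> = mf_flow T q t \<mu> \<alpha> T0"
  \<comment> \<open>A payoff constant in the measure is measurable, and at \<open>\<nu>\<close> it
    equals the remaining cost exactly.\<close>
  define \<psi> :: "'s \<Rightarrow> 's pmf \<Rightarrow> real" where "\<psi> = (\<lambda>x _. J T q F G T0 \<nu> \<alpha> x \<alpha>)"
  \<comment> \<open>A deviation in the truncated game is a deviation in the full game that returns
    to \<open>\<alpha>\<close> at \<open>T0\<close>, so optimality carries over.\<close>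
  have trunc: "J_trunc T q F T0 \<psi> t \<mu> \<alpha> x \<beta> = J T q F G t \<mu> \<alpha> x (concat_controls T0 \<beta> \<alpha>)" for x \<beta>
    unfolding \<psi>_def \<nu>_def J_def[of _ _ _ _ t] using times
    by (simp add: J_trunc_eq_cost J_restart J_flow_concat)
  have trunc_\<alpha>: "J_trunc T q F T0 \<psi> t \<mu> \<alpha> x \<alpha> = J T q F G t \<mu> \<alpha> x \<alpha>" for x
    unfolding trunc by (simp add: concat_controls_def[abs_def])
  have "\<alpha> \<in> M_state T A q F G \<epsilon> T0 \<nu>"
    unfolding \<nu>_def by (rule M_state_restart[OF F_bdd q_ge c times \<alpha> \<epsilon>(1)])
  then have "(\<lambda>x. \<psi> x \<nu>) \<in> V_state_eps T A q F G \<epsilon> T0 \<nu>"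
    using \<epsilon>(3) by (auto simp: V_state_eps_def \<psi>_def sup_norm_le_iff intro!: bexI[of _ \<alpha>])
  moreover have "\<alpha> \<in> M_trunc T A q F \<epsilon> T0 \<psi> t \<mu>"
  proof -
    have "J_trunc T q F T0 \<psi> t \<mu> \<alpha> x \<alpha> \<le> J_trunc T q F T0 \<psi> t \<mu> \<alpha> x \<beta> + \<epsilon>"
      if "\<beta> \<in> controls T A" for x \<beta>
      using \<alpha>_opt[OF concat_controls_mem[OF that \<alpha>_ctrl], of x T0] \<epsilon>(2) unfolding trunc_\<alpha> trunc[of _ \<beta>]
      by linarith
    then show ?thesis
      using times \<alpha>_ctrl by (simp add: M_trunc_iff[of T F A t, OF F_bdd])
  qed
  moreover have "sup_norm (\<lambda>x. \<phi> x - J_trunc T q F T0 \<psi> t \<mu> \<alpha> x \<alpha>) \<le> \<epsilon>"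
    unfolding sup_norm_le_iff trunc_\<alpha> using \<phi>_le \<epsilon>(2) order_trans by blast
  moreover have "\<psi> \<in> terminal_payoffs"
    unfolding \<psi>_def by (rule const_terminal_payoff)
  ultimately show ?thesis
    using \<alpha>_ctrl unfolding \<nu>_def by blast
qed

text \<open>Of the four errors, two come from exchanging \<open>\<psi>\<close> and the cost of
  \<open>\<beta>\<close>, one from the near-optimality of \<open>\<alpha>\<close> before
  \<open>T0\<close>, and one from that of \<open>\<beta>\<close> after \<open>T0\<close>.\<close>

lemma V_state_eps_paste:
  fixes q :: "nat \<Rightarrow> 's::finite \<Rightarrow> 's pmf \<Rightarrow> 'a \<Rightarrow> 's pmf"
  assumes F_bdd: "\<And>s x \<nu>. s \<le> T \<Longrightarrow> bdd_below (F s x \<nu> ` A)"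
    and times: "t \<le> T0" "T0 \<le> T"
    and V: "(\<lambda>x. \<psi> x (mf_flow T q t \<mu> \<alpha> T0)) \<in> V_state_eps T A q F G \<epsilon> T0 (mf_flow T q t \<mu> \<alpha> T0)"
    and M: "\<alpha> \<in> M_trunc T A q F \<epsilon> T0 \<psi> t \<mu>"
    and \<phi>: "sup_norm (\<lambda>x. \<phi> x - J_trunc T q F T0 \<psi> t \<mu> \<alpha> x \<alpha>) \<le> \<epsilon>" and "0 \<le> \<epsilon>"
  shows "\<phi> \<in> V_state_eps T A q F G (4 * \<epsilon>) t \<mu>"
proof -
  define m \<nu> where "m = mf_flow T q t \<mu> \<alpha>" and "\<nu> = m T0"
  from V obtain \<beta> where \<beta>: "\<beta> \<in> M_state T A q F G \<epsilon> T0 \<nu>"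
    and \<psi>: "\<And>y. \<bar>\<psi> y \<nu> - J T q F G T0 \<nu> \<beta> y \<beta>\<bar> \<le> \<epsilon>"
    by (auto simp: V_state_eps_def sup_norm_le_iff \<nu>_def m_def)
  have \<beta>_ctrl: "\<beta> \<in> controls T A" and \<beta>_opt:
    "\<And>y \<gamma>. \<gamma> \<in> controls T A \<Longrightarrow> J T q F G T0 \<nu> \<beta> y \<beta> \<le> J T q F G T0 \<nu> \<beta> y \<gamma> + \<epsilon>"
    using \<beta> times by (auto simp: M_state_iff[of T F A T0, OF F_bdd])
  define K where "K = (\<lambda>\<gamma> x. J_trunc T q F T0 \<psi> t \<mu> \<alpha> x \<gamma>)"
  have K: "K \<gamma> x = cost q F m \<gamma> t (T0 - t) (\<lambda>y. \<psi> y \<nu>) x" for \<gamma> x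
    using times by (simp add: K_def J_trunc_eq_cost m_def \<nu>_def)
  have \<alpha>_ctrl: "\<alpha> \<in> controls T A"
    and \<alpha>_opt: "\<And>x \<gamma>. \<gamma> \<in> controls T A \<Longrightarrow> K \<alpha> x \<le> K \<gamma> x + \<epsilon>"
    using M times by (auto simp: M_trunc_iff[of T F A t, OF F_bdd] K_def)
  define \<delta> where "\<delta> = concat_controls T0 \<alpha> \<beta>"
  \<comment> \<open>A deviating player still faces the flow of \<open>\<delta>\<close>:
    \<open>m\<close> up to \<open>T0\<close>, then the flow of \<open>\<beta>\<close> from
    \<open>\<nu>\<close>.\<close>
  have J\<delta>: "J T q F G t \<mu> \<delta> x \<gamma> = cost q F m \<gamma> t (T0 - t) (\<lambda>y. J T q F G T0 \<nu> \<beta> y \<gamma>) x" for x \<gamma>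
    using times by (simp add: \<delta>_def J_concat m_def \<nu>_def)
  have J\<delta>\<delta>: "J T q F G t \<mu> \<delta> x \<delta> = cost q F m \<alpha> t (T0 - t) (\<lambda>y. J T q F G T0 \<nu> \<beta> y \<beta>) x" for x
  proof -
    have "J T q F G T0 \<nu> \<beta> y \<delta> = J T q F G T0 \<nu> \<beta> y \<beta>" for y
      unfolding J_def using times by (intro J_flow_cong) (auto simp: \<delta>_def concat_controls_def)
    moreover have "cost q F m \<delta> t (T0 - t) = cost q F m \<alpha> t (T0 - t)"
      by (intro ext fun_cong[OF cost_cong]) (auto simp: \<delta>_def concat_controls_def)
    ultimately show ?thesis by (simp add: J\<delta>)
  qed
  have J_le: "J T q F G t \<mu> \<delta> x \<delta> \<le> K \<alpha> x + \<epsilon>" for x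
    unfolding J\<delta>\<delta> K by (rule cost_le_add_const) (use \<psi> in \<open>smt (verit)\<close>)
  have J_ge: "K \<alpha> x \<le> J T q F G t \<mu> \<delta> x \<delta> + \<epsilon>" for x
    unfolding J\<delta>\<delta> K by (rule cost_le_add_const) (use \<psi> in \<open>smt (verit)\<close>)
  \<comment> \<open>One error replaces \<open>\<psi>\<close> by the cost of \<open>\<beta>\<close>,
    the other lets the player deviate to \<open>\<gamma>\<close> after \<open>T0\<close>.\<close>
  have K_le: "K \<gamma> x \<le> J T q F G t \<mu> \<delta> x \<gamma> + 2 * \<epsilon>" if "\<gamma> \<in> controls T A" for \<gamma> x
    unfolding J\<delta> K by (rule cost_le_add_const) (use \<psi> \<beta>_opt[OF that] in \<open>smt (verit)\<close>)
  have "J T q F G t \<mu> \<delta> x \<delta> \<le> J T q F G t \<mu> \<delta> x \<gamma> + 4 * \<epsilon>" if "\<gamma> \<in> controls T A" for \<gamma> x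
    using J_le[of x] \<alpha>_opt[OF that, of x] K_le[OF that, of x] by linarith
  then have "\<delta> \<in> M_state T A q F G (4 * \<epsilon>) t \<mu>"
    using times \<alpha>_ctrl \<beta>_ctrl by (simp add: M_state_iff[of T F A t, OF F_bdd] \<delta>_def concat_controls_mem)
  moreover have "\<bar>\<phi> x - J T q F G t \<mu> \<delta> x \<delta>\<bar> \<le> 4 * \<epsilon>" for x
    using \<phi>[unfolded sup_norm_le_iff, rule_format, of x] J_le[of x] J_ge[of x] \<open>0 \<le> \<epsilon>\<close>
    unfolding K_def by linarith
  ultimately show ?thesis
    by (auto simp: V_state_eps_def sup_norm_le_iff)
qed

theorem theorem2p7:
  fixes T t T0 :: nat
    and A :: "(real ^ 'd0) set"
    and q :: "nat \<Rightarrow> 's::finite \<Rightarrow> 's pmf \<Rightarrow> real ^ 'd0 \<Rightarrow> 's pmf"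
    and F :: "nat \<Rightarrow> 's \<Rightarrow> 's pmf \<Rightarrow> real ^ 'd0 \<Rightarrow> real"
    and G :: "'s \<Rightarrow> 's pmf \<Rightarrow> real"
    and c\<^sub>q :: real
    and \<mu> :: "'s pmf"
  assumes A_meas: "A \<in> sets borel"
    and q_range: "\<And>s x \<nu> a y. s \<le> T \<Longrightarrow> a \<in> A \<Longrightarrow> pmf (q s x \<nu> a) y \<in> {0<..<1}"
    and F_meas: "(\<lambda>(s, x, \<nu>, a). F s x \<nu> a) \<in> borel_measurable
        (count_space {0..T} \<Otimes>\<^sub>M count_space UNIV \<Otimes>\<^sub>M borel_pmf \<Otimes>\<^sub>M restrict_space borel A)"
    and F_bdd: "\<And>s x \<nu>. s \<le> T \<Longrightarrow> bdd_below (F s x \<nu> ` A)"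
    and G_meas: "(\<lambda>(x, \<nu>). G x \<nu>) \<in> borel_measurable (count_space UNIV \<Otimes>\<^sub>M borel_pmf)"
    and c_pos: "c\<^sub>q > 0"
    and q_ge: "\<And>s x \<nu> a y. s \<le> T \<Longrightarrow> a \<in> A \<Longrightarrow> pmf (q s x \<nu> a) y \<ge> c\<^sub>q"
    and times: "t < T0" "T0 \<le> T"
    and \<mu>: "\<mu> \<in> full_support"
  shows "V_state T A q F G t \<mu> =
    (\<Inter>\<epsilon>\<in>{0<..}. {\<phi> \<in> borel_measurable (count_space UNIV).
       \<exists>\<psi>\<in>terminal_payoffs. \<exists>\<alpha>\<in>controls T A.
         (\<lambda>x. \<psi> x (mf_flow T q t \<mu> \<alpha> T0)) \<in> V_state_eps T A q F G \<epsilon> T0 (mf_flow T q t \<mu> \<alpha> T0) \<and>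
         \<alpha> \<in> M_trunc T A q F \<epsilon> T0 \<psi> t \<mu> \<and>
         sup_norm (\<lambda>x. \<phi> x - J_trunc T q F T0 \<psi> t \<mu> \<alpha> x \<alpha>) \<le> \<epsilon>})"
proof -
  let ?P = "\<lambda>\<phi> \<epsilon>. \<exists>\<psi>\<in>terminal_payoffs. \<exists>\<alpha>\<in>controls T A.
         (\<lambda>x. \<psi> x (mf_flow T q t \<mu> \<alpha> T0)) \<in> V_state_eps T A q F G \<epsilon> T0 (mf_flow T q t \<mu> \<alpha> T0) \<and>
         \<alpha> \<in> M_trunc T A q F \<epsilon> T0 \<psi> t \<mu> \<and>
         sup_norm (\<lambda>x. \<phi> x - J_trunc T q F T0 \<psi> t \<mu> \<alpha> x \<alpha>) \<le> \<epsilon>"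
  let ?R = "\<Inter>\<epsilon>\<in>{0<..}. {\<phi> \<in> borel_measurable (count_space UNIV). ?P \<phi> \<epsilon>}"
  show ?thesis
  proof (intro equalityI subsetI)
    fix \<phi>
    assume \<phi>: "\<phi> \<in> V_state T A q F G t \<mu>"
    show "\<phi> \<in> ?R"
    proof (intro INT_I CollectI conjI)
      fix \<epsilon> :: real
      assume "\<epsilon> \<in> {0<..}"
      \<comment> \<open>The minimum meets both tolerance requirements of
        \<open>V_state_eps_split\<close>.\<close>
      then have "0 < min \<epsilon> (c\<^sub>q * \<epsilon>)" "0 \<le> \<epsilon>"
        using c_pos by auto
      with \<phi> have "\<phi> \<in> V_state_eps T A q F G (min \<epsilon> (c\<^sub>q * \<epsilon>)) t \<mu>"
        by (auto simp: V_state_def)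
      from V_state_eps_split[OF F_bdd q_ge c_pos times this _ _ \<open>0 \<le> \<epsilon>\<close>]
      show "?P \<phi> \<epsilon>" by simp
    qed simp
  next
    fix \<phi>
    assume \<phi>: "\<phi> \<in> ?R"
    show "\<phi> \<in> V_state T A q F G t \<mu>"
      unfolding V_state_def
    proof (rule INT_I)
      fix \<epsilon> :: real
      assume "\<epsilon> \<in> {0<..}"
      \<comment> \<open>Pasting multiplies the tolerance by four.\<close>
      then have "\<epsilon> / 4 \<in> {0<..}" by simp
      with \<phi> have "?P \<phi> (\<epsilon> / 4)" by blast
      with \<open>\<epsilon> \<in> {0<..}\<close> show "\<phi> \<in> V_state_eps T A q F G \<epsilon> t \<mu>"
        using V_state_eps_paste[of T F A t T0 _ q \<mu> _ G "\<epsilon> / 4" \<phi>, OF F_bdd] times by auto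
    qed
  qed
qed

end
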